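(* Let $(\underline{X},\underline{A})=\{(X_i,A_i)\}_{i=1}^m$ be a sequence of power couples, let $c$ be a power sequence of length $m$, and let $I\subseteq[m]$. Suppose that $L\subseteq K$ are simplicial complexes on the vertex set $[m]$. Then $$\imath_{L_I,c}^{K_I,c}\circ p_{L,c}^{L_I,c}=p_{K,c}^{K_I,c}\circ\imath_{L,c}^{K,c}$$ as maps $(\underline{X},\underline{A})^{L,c}\to(\underline{X},\underline{A})^{K_I,c}$.
   Context: Conventions. Spaces are compactly generated, products are taken in that category, and maps are pointed. $\mathbb{N}=\{1,2,\dots\}$, $[m]=\{1,\dots,m\}$, $\Delta^{m-1}$ is the simplicial complex of all subsets of $[m]$ including $\emptyset$; a simplicial complex on $[m]$ contains $\emptyset$ and may have ghost vertices. Power couples. A pair $(X,A)$ is a pointed space $X$ with a subspace $A$ containing the basepoint. A power couple is a pair with maps of pairs $\rho_a\colon(X,A)\to(X,A)$, $a\in\mathbb{N}$, such that $\rho_1=\mathrm{id}$ and $\rho_a\circ\rho_b=\rho_{ab}$. Polyhedral products. $(\underline{X},\underline{A})^\sigma=\{(x_i)\in\prod_i X_i\mid x_i\in A_i\text{ if }i\notin\sigma\}$ and $(\underline{X},\underline{A})^K=\bigcup_{\sigma\in K}(\underline{X},\underline{A})^\sigma$. Power sequences. A power sequence is a map $c\colon\Delta^{m-1}\to\mathbb{N}^m$, $\sigma\mapsto(c_1^\sigma,\dots,c_m^\sigma)$, with $c_i^\sigma=1$ for $i\notin\sigma$ and $c_i^\tau\mid c_i^\sigma$ whenever $\tau\subseteq\sigma$.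 For $\tau\subseteq\sigma$, $\underline{c}^{\sigma/\tau}$ is the self-map of any polyhedral product obtained by restricting $\prod_i\rho_{c_i^\sigma/c_i^\tau}$. Weighted polyhedral products. Spaces $(\underline{X},\underline{A})^{\sigma,c}$ and maps $\eta(\sigma)\colon(\underline{X},\underline{A})^\sigma\to(\underline{X},\underline{A})^{\sigma,c}$ are defined by induction on $|\sigma|$, forming a functor on the face poset with structure maps $\imath_{\tau,c}^{\sigma,c}$, $\tau\subseteq\sigma$. First, $(\underline{X},\underline{A})^{\emptyset,c}=\prod_i A_i$, $\eta(\emptyset)=\mathrm{id}$. For $|\sigma|\ge1$, $(\underline{X},\underline{A})^{\partial\sigma,c}=\mathrm{colim}_{\tau\subsetneq\sigma}(\underline{X},\underline{A})^{\tau,c}$, the map $\eta(\partial\sigma)\colon(\underline{X},\underline{A})^{\partial\sigma}\to(\underline{X},\underline{A})^{\partial\sigma,c}$ is induced by the composites $(\underline{X},\underline{A})^\tau\xrightarrow{\underline{c}^{\sigma/\tau}}(\underline{X},\underline{A})^\tau\xrightarrow{\eta(\tau)}(\underline{X},\underline{A})^{\tau,c}\to(\underline{X},\underline{A})^{\partial\sigma,c}$ over $\tau\subsetneq\sigma$, and $(\underline{X},\underline{A})^{\sigma,c}$ is the pushout of the inclusion $(\underline{X},\underline{A})^{\partial\sigma}\to(\underline{X},\underline{A})^\sigma$ and $\eta(\partial\sigma)$, with $\eta(\sigma)$ the map from $(\underline{X},\underline{A})^\sigma$ and $\imath_{\partial\sigma,c}^{\sigma,c}$ the map from $(\underline{X},\underline{A})^{\partial\sigma,c}$.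 $(\underline{X},\underline{A})^{K,c}=\mathrm{colim}_{\sigma\in K}(\underline{X},\underline{A})^{\sigma,c}$, and for $L\subseteq K$ the map $\imath_{L,c}^{K,c}$ is the induced map of colimits. Restriction to $I$. For $I\subseteq[m]$, weighted polyhedral products of simplices and complexes on the vertex set $I$ are formed from $\{(X_i,A_i)\}_{i\in I}$ and the components $c_i^\sigma$, $i\in I$, $\sigma\subseteq I$. $K_I=\{\sigma\in K\mid\sigma\subseteq I\}$ is the full subcomplex, a simplicial complex on the vertex set $I$; for $\tau\in\Delta^{m-1}$, $\tau_I=\tau\cap I$ regarded as a simplex on $I$. Projections. $p_\tau^{\tau_I}\colon(\underline{X},\underline{A})^\tau\to(\underline{X},\underline{A})^{\tau_I}$ is the projection onto the coordinates in $I$. The maps $p_{\tau,c}^{\tau_I,c}\colon(\underline{X},\underline{A})^{\tau,c}\to(\underline{X},\underline{A})^{\tau_I,c}$ are the (well-defined) maps determined by induction on $|\tau|$ by $p_{\tau,c}^{\tau_I,c}\circ\eta(\tau)=\eta(\tau_I)\circ\underline{c}^{\tau/\tau_I}\circ p_\tau^{\tau_I}$ (only the components of $\underline{c}^{\tau/\tau_I}$ in $I$ being used) and $p_{\tau,c}^{\tau_I,c}\circ\imath_{\delta,c}^{\tau,c}=\imath_{\delta_I,c}^{\tau_I,c}\circ p_{\delta,c}^{\delta_I,c}$ for $\delta\subsetneq\tau$. The map $p_{K,c}^{K_I,c}\colon(\underline{X},\underline{A})^{K,c}\to(\underline{X},\underline{A})^{K_I,c}$ is induced on the colimit by the composites $(\underline{X},\underline{A})^{\tau,c}\xrightarrow{p_{\tau,c}^{\tau_I,c}}(\underline{X},\underline{A})^{\tau_I,c}\to(\underline{X},\underline{A})^{K_I,c}$,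 $\tau\in K$. *)

theory Defs
  imports "HOL-Analysis.Analysis"
begin

section \<open>Power couples and polyhedral products\<close>

record 'a couple =
  total :: "'a topology"
  part :: "'a set"
  basept :: 'a
  rho :: "nat \<Rightarrow> 'a \<Rightarrow> 'a"

text \<open>A compactly generated space is a \<^const>\<open>k_space\<close>, with no separation axiom. Subspaces and
  products are formed in the category of these spaces, that is, the usual topology is replaced
  by its \<^const>\<open>kification\<close>; this is why a pair imposes no condition on the topology
  that \<open>part P\<close> inherits from \<open>total P\<close>. The positive integers index the power maps.\<close>

definition power_couple :: "'a couple \<Rightarrow> bool" where
  "power_couple P \<longleftrightarrow>
     k_space (total P) \<and> part P \<subseteq> topspace (total P) \<and> basept P \<in> part P \<and>
     (\<forall>a\<ge>1. continuous_map (total P) (total P) (rho P a) \<and>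
             rho P a ` part P \<subseteq> part P \<and> rho P a (basept P) = basept P) \<and>
     (\<forall>x\<in>topspace (total P). rho P 1 x = x) \<and>
     (\<forall>a\<ge>1. \<forall>b\<ge>1. \<forall>x\<in>topspace (total P). rho P a (rho P b x) = rho P (a * b) x)"

definition abs_simplicial_complex :: "nat set \<Rightarrow> nat set set \<Rightarrow> bool" where
  "abs_simplicial_complex V K \<longleftrightarrow>
     K \<subseteq> Pow V \<and> {} \<in> K \<and> (\<forall>\<sigma>\<in>K. \<forall>\<tau>. \<tau> \<subseteq> \<sigma> \<longrightarrow> \<tau> \<in> K)"

definition full_subcomplex :: "nat set set \<Rightarrow> nat set \<Rightarrow> nat set set" where
  "full_subcomplex K I = {\<sigma> \<in> K. \<sigma> \<subseteq> I}"

definition power_sequence :: "nat \<Rightarrow> (nat set \<Rightarrow> nat \<Rightarrow> nat) \<Rightarrow> bool" where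
  "power_sequence m c \<longleftrightarrow>
     (\<forall>\<sigma>. \<sigma> \<subseteq> {1..m} \<longrightarrow> (\<forall>i\<in>{1..m}. c \<sigma> i \<ge> 1 \<and> (i \<notin> \<sigma> \<longrightarrow> c \<sigma> i = 1))) \<and>
     (\<forall>\<sigma> \<tau>. \<tau> \<subseteq> \<sigma> \<and> \<sigma> \<subseteq> {1..m} \<longrightarrow> (\<forall>i\<in>{1..m}. c \<tau> i dvd c \<sigma> i))"

text \<open>Below \<open>V\<close> is the vertex set: it is \<open>{1..m}\<close> or a subset \<open>I\<close> of it, so restriction to
  \<open>I\<close> amounts to replacing \<open>V\<close> by \<open>I\<close>.\<close>

definition pp_simplex :: "nat set \<Rightarrow> (nat \<Rightarrow> 'a couple) \<Rightarrow> nat set \<Rightarrow> (nat \<Rightarrow> 'a) set" where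
  "pp_simplex V P \<sigma> =
     {x \<in> (\<Pi>\<^sub>E i\<in>V. topspace (total (P i))). \<forall>i\<in>V - \<sigma>. x i \<in> part (P i)}"

definition pp :: "nat set \<Rightarrow> (nat \<Rightarrow> 'a couple) \<Rightarrow> nat set set \<Rightarrow> (nat \<Rightarrow> 'a) set" where
  "pp V P K = (\<Union>\<sigma>\<in>K. pp_simplex V P \<sigma>)"

definition k_product :: "nat set \<Rightarrow> (nat \<Rightarrow> 'a couple) \<Rightarrow> (nat \<Rightarrow> 'a) topology" where
  "k_product V P = kification (product_topology (\<lambda>i. total (P i)) V)"

definition pp_simplex_top ::
    "nat set \<Rightarrow> (nat \<Rightarrow> 'a couple) \<Rightarrow> nat set \<Rightarrow> (nat \<Rightarrow> 'a) topology" where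
  "pp_simplex_top V P \<sigma> = kification (subtopology (k_product V P) (pp_simplex V P \<sigma>))"

definition power_map :: "nat set \<Rightarrow> (nat \<Rightarrow> 'a couple) \<Rightarrow> (nat set \<Rightarrow> nat \<Rightarrow> nat) \<Rightarrow>
    nat set \<Rightarrow> nat set \<Rightarrow> (nat \<Rightarrow> 'a) \<Rightarrow> (nat \<Rightarrow> 'a)" where
  "power_map V P c \<sigma> \<tau> x = (\<lambda>i\<in>V. rho (P i) (c \<sigma> i div c \<tau> i) (x i))"

section \<open>Colimits and pushouts\<close>

text \<open>Iterated gluings of spaces with points of type \<open>'x\<close> are all realised on the one type
  \<open>'x glued\<close>: the constructors label the summands of the disjoint unions, and a quotient is
  realised by a chosen representative of each class. Colimits of compactly generated spaces
  have the colimit topology of topological spaces.\<close>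

datatype 'x glued = Cell 'x | Old "'x glued" | Face "nat set" "'x glued"

definition class_rep :: "('b \<Rightarrow> 'b \<Rightarrow> bool) \<Rightarrow> 'b \<Rightarrow> 'b" where
  "class_rep r x = (SOME y. equivclp r x y)"

text \<open>The diagram consists of the spaces \<open>F j\<close>, for \<open>j \<in> J\<close>, and of the maps
  \<open>f j k : F j \<rightarrow> F k\<close>, for \<open>j \<subseteq> k\<close> in \<open>J\<close>.\<close>

definition colim_rel :: "nat set set \<Rightarrow> (nat set \<Rightarrow> 'x glued topology) \<Rightarrow>
    (nat set \<Rightarrow> nat set \<Rightarrow> 'x glued \<Rightarrow> 'x glued) \<Rightarrow> 'x glued \<Rightarrow> 'x glued \<Rightarrow> bool" where
  "colim_rel J F f p q \<longleftrightarrow>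
     (\<exists>j\<in>J. \<exists>k\<in>J. j \<subseteq> k \<and> (\<exists>x\<in>topspace (F j). p = Face j x \<and> q = Face k (f j k x)))"

definition colim_in :: "nat set set \<Rightarrow> (nat set \<Rightarrow> 'x glued topology) \<Rightarrow>
    (nat set \<Rightarrow> nat set \<Rightarrow> 'x glued \<Rightarrow> 'x glued) \<Rightarrow> nat set \<Rightarrow> 'x glued \<Rightarrow> 'x glued" where
  "colim_in J F f j x = class_rep (colim_rel J F f) (Face j x)"

definition colim :: "nat set set \<Rightarrow> (nat set \<Rightarrow> 'x glued topology) \<Rightarrow>
    (nat set \<Rightarrow> nat set \<Rightarrow> 'x glued \<Rightarrow> 'x glued) \<Rightarrow> 'x glued topology" where
  "colim J F f = topology (\<lambda>U.
     U \<subseteq> (\<Union>j\<in>J. colim_in J F f j ` topspace (F j)) \<and>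
     (\<forall>j\<in>J. openin (F j) {x \<in> topspace (F j). colim_in J F f j x \<in> U}))"

text \<open>The map out of the colimit induced by the maps \<open>g j\<close> out of \<open>F j\<close>.\<close>

definition colim_desc :: "nat set set \<Rightarrow> (nat set \<Rightarrow> 'x glued topology) \<Rightarrow>
    (nat set \<Rightarrow> nat set \<Rightarrow> 'x glued \<Rightarrow> 'x glued) \<Rightarrow>
    (nat set \<Rightarrow> 'x glued \<Rightarrow> 'y) \<Rightarrow> 'x glued \<Rightarrow> 'y" where
  "colim_desc J F f g y =
     (THE z. \<forall>j\<in>J. \<forall>x\<in>topspace (F j). colim_in J F f j x = y \<longrightarrow> z = g j x)"

text \<open>The pushout of the inclusion of a subspace with underlying set \<open>S\<close> into \<open>B\<close> and of a map
  \<open>g\<close> from that subspace to \<open>C\<close>. It does not depend on the topology of the subspace.\<close>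

definition pushout_rel :: "'x set \<Rightarrow> ('x \<Rightarrow> 'x glued) \<Rightarrow> 'x glued \<Rightarrow> 'x glued \<Rightarrow> bool" where
  "pushout_rel S g p q \<longleftrightarrow> (\<exists>s\<in>S. p = Cell s \<and> q = Old (g s))"

definition pushout_cell :: "'x set \<Rightarrow> ('x \<Rightarrow> 'x glued) \<Rightarrow> 'x \<Rightarrow> 'x glued" where
  "pushout_cell S g x = class_rep (pushout_rel S g) (Cell x)"

definition pushout_old :: "'x set \<Rightarrow> ('x \<Rightarrow> 'x glued) \<Rightarrow> 'x glued \<Rightarrow> 'x glued" where
  "pushout_old S g y = class_rep (pushout_rel S g) (Old y)"

definition pushout ::
    "'x topology \<Rightarrow> 'x glued topology \<Rightarrow> 'x set \<Rightarrow> ('x \<Rightarrow> 'x glued) \<Rightarrow> 'x glued topology" where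
  "pushout B C S g = topology (\<lambda>U.
     U \<subseteq> pushout_cell S g ` topspace B \<union> pushout_old S g ` topspace C \<and>
     openin B {x \<in> topspace B. pushout_cell S g x \<in> U} \<and>
     openin C {y \<in> topspace C. pushout_old S g y \<in> U})"

section \<open>Weighted polyhedral products\<close>

text \<open>The data at a simplex \<open>\<sigma>\<close>: the space, the map \<open>\<eta>(\<sigma>)\<close>, and the structure maps from the
  faces \<open>\<tau>\<close> of \<open>\<sigma>\<close>.\<close>

type_synonym 'a wpp_data =
  "(nat \<Rightarrow> 'a) glued topology \<times> ((nat \<Rightarrow> 'a) \<Rightarrow> (nat \<Rightarrow> 'a) glued) \<times>
   (nat set \<Rightarrow> (nat \<Rightarrow> 'a) glued \<Rightarrow> (nat \<Rightarrow> 'a) glued)"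

text \<open>\<open>D\<close> provides the data at the proper faces of \<open>\<sigma>\<close>. For \<open>\<sigma> = {}\<close> the boundary is empty, and
  the pushout is \<open>pp_simplex_top V P {}\<close> (the product of the subspaces), with \<open>Cell\<close>
  in the role of the identity \<open>\<eta>({})\<close>.\<close>

definition wpp_step :: "nat set \<Rightarrow> (nat \<Rightarrow> 'a couple) \<Rightarrow> (nat set \<Rightarrow> nat \<Rightarrow> nat) \<Rightarrow> nat set \<Rightarrow>
    (nat set \<Rightarrow> 'a wpp_data) \<Rightarrow> 'a wpp_data" where
  "wpp_step V P c \<sigma> D =
    (let bd = {\<tau>. \<tau> \<subset> \<sigma>};
         W = (\<lambda>\<tau>. fst (D \<tau>));
         eta = (\<lambda>\<tau>. fst (snd (D \<tau>)));
         iota = (\<lambda>\<delta> \<tau>. snd (snd (D \<tau>)) \<delta>);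
         W_bd = colim bd W iota;
         in_bd = colim_in bd W iota;
         eta_bd = (\<lambda>x. THE y. \<forall>\<tau>\<in>bd. x \<in> pp_simplex V P \<tau> \<longrightarrow>
                                y = in_bd \<tau> (eta \<tau> (power_map V P c \<sigma> \<tau> x)))
     in (pushout (pp_simplex_top V P \<sigma>) W_bd (pp V P bd) eta_bd,
         pushout_cell (pp V P bd) eta_bd,
         (\<lambda>\<tau> y. if \<tau> = \<sigma> then y else pushout_old (pp V P bd) eta_bd (in_bd \<tau> y))))"

text \<open>The guards here and in \<open>wproj_simplex\<close> are only for termination; simplices are finite.\<close>

function wpp_data :: "nat set \<Rightarrow> (nat \<Rightarrow> 'a couple) \<Rightarrow> (nat set \<Rightarrow> nat \<Rightarrow> nat) \<Rightarrow> nat set \<Rightarrow>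
    'a wpp_data" where
  "wpp_data V P c \<sigma> =
     wpp_step V P c \<sigma> (\<lambda>\<tau>. if finite \<sigma> \<and> \<tau> \<subset> \<sigma> then wpp_data V P c \<tau> else undefined)"
  by pat_completeness auto
termination
  by (relation "Wellfounded.measure (\<lambda>(V, P, c, \<sigma>). card \<sigma>)") (auto intro: psubset_card_mono)

declare wpp_data.simps [simp del]

definition wpp_simplex :: "nat set \<Rightarrow> (nat \<Rightarrow> 'a couple) \<Rightarrow> (nat set \<Rightarrow> nat \<Rightarrow> nat) \<Rightarrow> nat set \<Rightarrow>
    (nat \<Rightarrow> 'a) glued topology" where
  "wpp_simplex V P c \<sigma> = fst (wpp_data V P c \<sigma>)"

definition eta :: "nat set \<Rightarrow> (nat \<Rightarrow> 'a couple) \<Rightarrow> (nat set \<Rightarrow> nat \<Rightarrow> nat) \<Rightarrow> nat set \<Rightarrow>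
    (nat \<Rightarrow> 'a) \<Rightarrow> (nat \<Rightarrow> 'a) glued" where
  "eta V P c \<sigma> = fst (snd (wpp_data V P c \<sigma>))"

definition iota_simplex :: "nat set \<Rightarrow> (nat \<Rightarrow> 'a couple) \<Rightarrow> (nat set \<Rightarrow> nat \<Rightarrow> nat) \<Rightarrow>
    nat set \<Rightarrow> nat set \<Rightarrow> (nat \<Rightarrow> 'a) glued \<Rightarrow> (nat \<Rightarrow> 'a) glued" where
  "iota_simplex V P c \<tau> \<sigma> = snd (snd (wpp_data V P c \<sigma>)) \<tau>"

definition wpp :: "nat set \<Rightarrow> (nat \<Rightarrow> 'a couple) \<Rightarrow> (nat set \<Rightarrow> nat \<Rightarrow> nat) \<Rightarrow> nat set set \<Rightarrow>
    (nat \<Rightarrow> 'a) glued topology" where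
  "wpp V P c K = colim K (wpp_simplex V P c) (iota_simplex V P c)"

definition wpp_in :: "nat set \<Rightarrow> (nat \<Rightarrow> 'a couple) \<Rightarrow> (nat set \<Rightarrow> nat \<Rightarrow> nat) \<Rightarrow> nat set set \<Rightarrow>
    nat set \<Rightarrow> (nat \<Rightarrow> 'a) glued \<Rightarrow> (nat \<Rightarrow> 'a) glued" where
  "wpp_in V P c K = colim_in K (wpp_simplex V P c) (iota_simplex V P c)"

definition wpp_basept :: "nat set \<Rightarrow> (nat \<Rightarrow> 'a couple) \<Rightarrow> (nat set \<Rightarrow> nat \<Rightarrow> nat) \<Rightarrow>
    nat set set \<Rightarrow> (nat \<Rightarrow> 'a) glued" where
  "wpp_basept V P c K = wpp_in V P c K {} (eta V P c {} (\<lambda>i\<in>V. basept (P i)))"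

definition iota :: "nat set \<Rightarrow> (nat \<Rightarrow> 'a couple) \<Rightarrow> (nat set \<Rightarrow> nat \<Rightarrow> nat) \<Rightarrow>
    nat set set \<Rightarrow> nat set set \<Rightarrow> (nat \<Rightarrow> 'a) glued \<Rightarrow> (nat \<Rightarrow> 'a) glued" where
  "iota V P c L K =
     colim_desc L (wpp_simplex V P c) (iota_simplex V P c) (wpp_in V P c K)"

section \<open>Projections\<close>

text \<open>\<open>wproj_simplex V I P c \<tau>\<close> is the map out of the weighted polyhedral product of \<open>\<tau>\<close> on the
  vertex set \<open>V\<close> that is determined, by induction on \<open>card \<tau>\<close>, by its composites with \<open>\<eta>(\<tau>)\<close>
  and with the structure maps from the proper faces of \<open>\<tau>\<close>.\<close>

function wproj_simplex :: "nat set \<Rightarrow> nat set \<Rightarrow> (nat \<Rightarrow> 'a couple) \<Rightarrow>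
    (nat set \<Rightarrow> nat \<Rightarrow> nat) \<Rightarrow> nat set \<Rightarrow> (nat \<Rightarrow> 'a) glued \<Rightarrow> (nat \<Rightarrow> 'a) glued" where
  "wproj_simplex V I P c \<tau> y = (THE z.
     (\<forall>x\<in>pp_simplex V P \<tau>. eta V P c \<tau> x = y \<longrightarrow>
        z = eta I P c (\<tau> \<inter> I) (power_map I P c \<tau> (\<tau> \<inter> I) (restrict x I))) \<and>
     (\<forall>\<delta>. finite \<tau> \<and> \<delta> \<subset> \<tau> \<longrightarrow>
        (\<forall>w\<in>topspace (wpp_simplex V P c \<delta>). iota_simplex V P c \<delta> \<tau> w = y \<longrightarrow>
           z = iota_simplex I P c (\<delta> \<inter> I) (\<tau> \<inter> I) (wproj_simplex V I P c \<delta> w))))"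
  by pat_completeness auto
termination
  by (relation "Wellfounded.measure (\<lambda>(V, I, P, c, \<tau>, y). card \<tau>)") (auto intro: psubset_card_mono)

declare wproj_simplex.simps [simp del]

definition wproj :: "nat set \<Rightarrow> nat set \<Rightarrow> (nat \<Rightarrow> 'a couple) \<Rightarrow> (nat set \<Rightarrow> nat \<Rightarrow> nat) \<Rightarrow>
    nat set set \<Rightarrow> (nat \<Rightarrow> 'a) glued \<Rightarrow> (nat \<Rightarrow> 'a) glued" where
  "wproj V I P c K =
     colim_desc K (wpp_simplex V P c) (iota_simplex V P c)
       (\<lambda>\<tau> w. wpp_in I P c (full_subcomplex K I) (\<tau> \<inter> I) (wproj_simplex V I P c \<tau> w))"

definition pointed_map ::
    "'s topology \<Rightarrow> 's \<Rightarrow> 't topology \<Rightarrow> 't \<Rightarrow> ('s \<Rightarrow> 't) \<Rightarrow> bool" where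
  "pointed_map S s T t f \<longleftrightarrow> continuous_map S T f \<and> f s = t"

text \<open>Equality of morphisms \<open>(S, s) \<rightarrow> (T, t)\<close>; HOL functions carry irrelevant values outside
  \<open>topspace S\<close>.\<close>

definition equal_pointed_maps ::
    "'s topology \<Rightarrow> 's \<Rightarrow> 't topology \<Rightarrow> 't \<Rightarrow> ('s \<Rightarrow> 't) \<Rightarrow> ('s \<Rightarrow> 't) \<Rightarrow> bool" where
  "equal_pointed_maps S s T t f g \<longleftrightarrow>
     pointed_map S s T t f \<and> pointed_map S s T t g \<and> (\<forall>y\<in>topspace S. f y = g y)"

end

theory Submission
  imports Defs
begin

text \<open>Both composites are maps out of a colimit, so they agree once they agree on the image of
  each weighted simplex \<open>\<tau>\<close> of \<open>L\<close>. There both are the projection of the weighted simplex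
  \<open>\<tau>\<close> to that of \<open>\<tau> \<inter> I\<close> followed by the map into the colimit over the full subcomplex of
  \<open>K\<close> on \<open>I\<close> (lemmas \<open>wproj_wpp_in\<close> and \<open>iota_wpp_in\<close>), and the equality is immediate.

  The work lies in showing that the maps are what they are meant to be. Every map
  out of a gluing is specified by a definite description, which has the intended value only if the
  prescribed values on the pieces are compatible. Three compatibilities carry the proof.

  First, \<open>\<eta>\<close> of a simplex restricts on each face to \<open>\<eta>\<close> of the face, precomposed with a
  power map (lemma \<open>eta_face\<close>). The induction needs the power maps of nested faces
  to compose, which is where the relation between \<open>\<rho>\<^sub>a\<close>, \<open>\<rho>\<^sub>b\<close> and \<open>\<rho>\<^sub>a\<^sub>b\<close> and the divisibility
  of the exponents enter, and the fact that a point lying in two faces lies in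
  their intersection.

  Secondly, the structure maps between weighted simplices are functorial
  (lemma \<open>iota_simplex_trans\<close>).

  Thirdly, the projection of a weighted simplex has the prescribed composites with \<open>\<eta>\<close> and
  with the structure maps from the faces (lemma \<open>wproj_simplex_correct\<close>). By induction, the values
  prescribed on the faces agree with each other by functoriality on the vertex set \<open>I\<close>, and with
  those prescribed on the cell because, for a face \<open>\<delta>\<close> of \<open>\<tau>\<close>, raising first to the
  exponents from \<open>\<delta>\<close> to \<open>\<tau>\<close> and then to those from \<open>\<delta> \<inter> I\<close> to \<open>\<delta>\<close> has the same effect on the
  coordinates in \<open>I\<close> as passing through \<open>\<tau> \<inter> I\<close>.

  Continuity is checked on the pieces, all the gluings carrying final topologies;
  on cells it is the functoriality of kification.\<close>

section \<open>Quotients and final topologies\<close>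

lemma class_rep_eqI:
  assumes "r x y"
  shows "class_rep r x = class_rep r y"
proof -
  have "equivclp r x = equivclp r y"
    using assms by (intro ext) (metis equivclp_sym equivclp_trans r_into_equivclp)
  then show ?thesis
    by (simp add: class_rep_def)
qed

text \<open>A representative is an actual point of the class, so a function invariant under the
  relation is its own descent to the quotient.\<close>

lemma invariant_class_rep:
  assumes "\<And>p q. r p q \<Longrightarrow> h p = h q"
  shows "h (class_rep r x) = h x"
proof -
  have inv: "h p = h q" if "equivclp r p q" for p q
    using that by (induction rule: equivclp_induct) (use assms in metis)+
  have "equivclp r x (class_rep r x)"
    unfolding class_rep_def by (rule someI[of _ x]) simp
  then show ?thesis
    using inv by metis
qed

lemma istopology_subset: "istopology (\<lambda>U. U \<subseteq> T)"
  by (auto simp: istopology_def)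

lemma istopology_conj:
  "istopology L \<Longrightarrow> istopology M \<Longrightarrow> istopology (\<lambda>U. L U \<and> M U)"
  by (simp add: istopology_def)

lemma istopology_ball:
  "(\<And>j. j \<in> J \<Longrightarrow> istopology (L j)) \<Longrightarrow> istopology (\<lambda>U. \<forall>j\<in>J. L j U)"
  by (simp add: istopology_def)

text \<open>The gluings are given by openness predicates that are conjunctions of conditions of this
  form; that these are topologies is needed before anything about their open sets can be used.\<close>

lemma istopology_preimage: "istopology (\<lambda>U. openin X {x \<in> topspace X. q x \<in> U})"
proof -
  have "{x \<in> topspace X. q x \<in> S \<inter> T} =
      {x \<in> topspace X. q x \<in> S} \<inter> {x \<in> topspace X. q x \<in> T}" for S T
    by auto
  moreover have "{x \<in> topspace X. q x \<in> \<Union>\<K>} = (\<Union>S\<in>\<K>. {x \<in> topspace X. q x \<in> S})" for \<K>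
    by auto
  ultimately show ?thesis
    by (auto simp: istopology_def)
qed

section \<open>Universal properties of colimits and pushouts\<close>

lemma openin_colim:
  "openin (colim J F f) U \<longleftrightarrow>
     U \<subseteq> (\<Union>j\<in>J. colim_in J F f j ` topspace (F j)) \<and>
     (\<forall>j\<in>J. openin (F j) {x \<in> topspace (F j). colim_in J F f j x \<in> U})"
  unfolding colim_def
  by (subst topology_inverse')
    (intro istopology_conj istopology_ball istopology_subset istopology_preimage, rule refl)

lemma topspace_colim: "topspace (colim J F f) = (\<Union>j\<in>J. colim_in J F f j ` topspace (F j))"
proof (rule antisym)
  show "topspace (colim J F f) \<subseteq> (\<Union>j\<in>J. colim_in J F f j ` topspace (F j))"
    using openin_colim openin_topspace by metis
  have *: "{x \<in> topspace (F j). colim_in J F f j x \<in> (\<Union>j\<in>J. colim_in J F f j ` topspace (F j))}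
      = topspace (F j)" if "j \<in> J" for j
    using that by blast
  show "(\<Union>j\<in>J. colim_in J F f j ` topspace (F j)) \<subseteq> topspace (colim J F f)"
    by (intro openin_subset openin_colim[THEN iffD2] conjI ballI subset_refl)
      (simp only: * openin_topspace)
qed

lemma continuous_map_colim_in:
  assumes "j \<in> J"
  shows "continuous_map (F j) (colim J F f) (colim_in J F f j)"
  unfolding continuous_map_def using assms by (auto simp: topspace_colim openin_colim)

lemma continuous_map_from_colim:
  assumes "\<And>j. j \<in> J \<Longrightarrow> continuous_map (F j) Y (\<lambda>x. h (colim_in J F f j x))"
  shows "continuous_map (colim J F f) Y h"
  unfolding continuous_map_def
proof (intro conjI allI impI)
  show "h \<in> topspace (colim J F f) \<rightarrow> topspace Y"
    using assms by (auto simp: topspace_colim continuous_map_def)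
  fix U assume U: "openin Y U"
  have "{x \<in> topspace (F j). colim_in J F f j x \<in> {x \<in> topspace (colim J F f). h x \<in> U}} =
      {x \<in> topspace (F j). h (colim_in J F f j x) \<in> U}" if "j \<in> J" for j
    using that by (auto simp: topspace_colim)
  then show "openin (colim J F f) {x \<in> topspace (colim J F f). h x \<in> U}"
    using assms U by (auto simp: openin_colim topspace_colim continuous_map_def)
qed

lemma colim_in_glue:
  assumes "j \<in> J" "k \<in> J" "j \<subseteq> k" "x \<in> topspace (F j)"
  shows "colim_in J F f k (f j k x) = colim_in J F f j x"
  unfolding colim_in_def by (rule class_rep_eqI[symmetric]) (use assms in \<open>auto simp: colim_rel_def\<close>)

text \<open>The induced map is read off from the label \<open>Face j x\<close>; hence the equation also holds at
  labels outside the diagram.\<close>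

lemma colim_universal:
  assumes "\<And>j k x. j \<in> J \<Longrightarrow> k \<in> J \<Longrightarrow> j \<subseteq> k \<Longrightarrow> x \<in> topspace (F j) \<Longrightarrow> g k (f j k x) = g j x"
  obtains h where "\<And>j x. h (colim_in J F f j x) = g j x"
proof
  define h where "h p = (case p of Face j x \<Rightarrow> g j x)" for p
  have "h p = h q" if "colim_rel J F f p q" for p q
    using that assms by (auto simp: colim_rel_def h_def)
  then show "h (colim_in J F f j x) = g j x" for j x
    using invariant_class_rep[of "colim_rel J F f" h "Face j x"] by (simp add: colim_in_def h_def)
qed

text \<open>Compatible maps out of the diagram pin down a single value at each point of the colimit,
  which is what makes the definite description behave as the induced map.\<close>

lemma colim_desc_in:
  assumes "\<And>j k x. j \<in> J \<Longrightarrow> k \<in> J \<Longrightarrow> j \<subseteq> k \<Longrightarrow> x \<in> topspace (F j) \<Longrightarrow> g k (f j k x) = g j x"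
    and "j \<in> J" "x \<in> topspace (F j)"
  shows "colim_desc J F f g (colim_in J F f j x) = g j x"
proof -
  obtain h where h: "\<And>j x. h (colim_in J F f j x) = g j x"
    using colim_universal[of J F g f, OF assms(1)] by blast
  have "g k y = g j x" if "colim_in J F f k y = colim_in J F f j x" for k y
    using arg_cong[OF that, of h] by (simp only: h)
  then show ?thesis
    unfolding colim_desc_def using assms(2,3) by (intro the_equality) (metis, blast)
qed

lemma continuous_map_colim_desc:
  assumes "\<And>j k x. j \<in> J \<Longrightarrow> k \<in> J \<Longrightarrow> j \<subseteq> k \<Longrightarrow> x \<in> topspace (F j) \<Longrightarrow> g k (f j k x) = g j x"
    and "\<And>j. j \<in> J \<Longrightarrow> continuous_map (F j) Y (g j)"
  shows "continuous_map (colim J F f) Y (colim_desc J F f g)"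
proof (rule continuous_map_from_colim)
  fix j assume "j \<in> J"
  show "continuous_map (F j) Y (\<lambda>x. colim_desc J F f g (colim_in J F f j x))"
    by (rule continuous_map_eq[OF assms(2)[OF \<open>j \<in> J\<close>]])
      (rule colim_desc_in[of J F g f, OF assms(1) \<open>j \<in> J\<close>, symmetric])
qed

text \<open>The boundary of a simplex is glued from data that is only correct on its proper faces; the
  colimit does not see the difference.\<close>

lemma colim_cong:
  assumes "\<And>j. j \<in> J \<Longrightarrow> F j = F' j" "\<And>j k. j \<in> J \<Longrightarrow> k \<in> J \<Longrightarrow> f j k = f' j k"
  shows "colim_in J F f = colim_in J F' f'" "colim J F f = colim J F' f'"
proof -
  have "colim_rel J F f = colim_rel J F' f'"
    using assms by (auto simp: colim_rel_def fun_eq_iff)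
  then show *: "colim_in J F f = colim_in J F' f'"
    by (simp add: colim_in_def[abs_def])
  show "colim J F f = colim J F' f'"
    unfolding colim_def * using assms(1) by (intro arg_cong[where f=topology] ext) auto
qed

lemma openin_pushout:
  "openin (pushout B C S g) U \<longleftrightarrow>
     U \<subseteq> pushout_cell S g ` topspace B \<union> pushout_old S g ` topspace C \<and>
     openin B {x \<in> topspace B. pushout_cell S g x \<in> U} \<and>
     openin C {y \<in> topspace C. pushout_old S g y \<in> U}"
  unfolding pushout_def
  by (subst topology_inverse')
    (intro istopology_conj istopology_subset istopology_preimage, rule refl)

lemma topspace_pushout:
  "topspace (pushout B C S g) = pushout_cell S g ` topspace B \<union> pushout_old S g ` topspace C"
    (is "_ = ?T")
proof (rule antisym)
  show "topspace (pushout B C S g) \<subseteq> ?T"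
    using openin_pushout openin_topspace by metis
  have "{x \<in> topspace B. pushout_cell S g x \<in> ?T} = topspace B"
    "{y \<in> topspace C. pushout_old S g y \<in> ?T} = topspace C"
    by auto
  then show "?T \<subseteq> topspace (pushout B C S g)"
    by (intro openin_subset) (simp only: openin_pushout openin_topspace subset_refl simp_thms)
qed

lemma continuous_map_pushout_cell: "continuous_map B (pushout B C S g) (pushout_cell S g)"
  unfolding continuous_map_def by (auto simp: topspace_pushout openin_pushout)

lemma continuous_map_pushout_old: "continuous_map C (pushout B C S g) (pushout_old S g)"
  unfolding continuous_map_def by (auto simp: topspace_pushout openin_pushout)

lemma continuous_map_from_pushout:
  assumes "continuous_map B Y (\<lambda>x. h (pushout_cell S g x))"
    and "continuous_map C Y (\<lambda>y. h (pushout_old S g y))"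
  shows "continuous_map (pushout B C S g) Y h"
  unfolding continuous_map_def
proof (intro conjI allI impI)
  show "h \<in> topspace (pushout B C S g) \<rightarrow> topspace Y"
    using assms by (auto simp: topspace_pushout continuous_map_def)
  fix U assume U: "openin Y U"
  let ?U = "{x \<in> topspace (pushout B C S g). h x \<in> U}"
  have "{x \<in> topspace B. pushout_cell S g x \<in> ?U} = {x \<in> topspace B. h (pushout_cell S g x) \<in> U}"
    "{y \<in> topspace C. pushout_old S g y \<in> ?U} = {y \<in> topspace C. h (pushout_old S g y) \<in> U}"
    by (auto simp: topspace_pushout)
  then show "openin (pushout B C S g) ?U"
    using assms U by (auto simp: openin_pushout topspace_pushout continuous_map_def)
qed

lemma pushout_glue:
  assumes "s \<in> S"
  shows "pushout_cell S g s = pushout_old S g (g s)"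
  unfolding pushout_cell_def pushout_old_def
  by (rule class_rep_eqI) (use assms in \<open>auto simp: pushout_rel_def\<close>)

lemma pushout_universal:
  assumes "\<And>s. s \<in> S \<Longrightarrow> hc s = ho (g s)"
  obtains h where "\<And>x. h (pushout_cell S g x) = hc x" "\<And>y. h (pushout_old S g y) = ho y"
proof
  define h where "h p = (case p of Cell x \<Rightarrow> hc x | Old y \<Rightarrow> ho y)" for p
  have inv: "h p = h q" if "pushout_rel S g p q" for p q
    using that assms by (auto simp: pushout_rel_def h_def)
  show "h (pushout_cell S g x) = hc x" for x
    using invariant_class_rep[of "pushout_rel S g" h "Cell x", OF inv]
    by (simp add: pushout_cell_def h_def)
  show "h (pushout_old S g y) = ho y" for y
    using invariant_class_rep[of "pushout_rel S g" h "Old y", OF inv]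
    by (simp add: pushout_old_def h_def)
qed

section \<open>The gluing of a weighted simplex\<close>

text \<open>The map \<open>\<eta>(\<partial>\<sigma>)\<close>, in the form in which it occurs in the recursion; the recursive
  calls are replaced by the constants for the faces.\<close>

definition eta_boundary :: "nat set \<Rightarrow> (nat \<Rightarrow> 'a couple) \<Rightarrow> (nat set \<Rightarrow> nat \<Rightarrow> nat) \<Rightarrow>
    nat set \<Rightarrow> (nat \<Rightarrow> 'a) \<Rightarrow> (nat \<Rightarrow> 'a) glued" where
  "eta_boundary V P c \<sigma> x = (THE y. \<forall>\<tau>\<in>{\<tau>. \<tau> \<subset> \<sigma>}. x \<in> pp_simplex V P \<tau> \<longrightarrow>
     y = wpp_in V P c {\<tau>. \<tau> \<subset> \<sigma>} \<tau> (eta V P c \<tau> (power_map V P c \<sigma> \<tau> x)))"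

text \<open>The boundary of \<open>\<sigma>\<close> is itself a weighted polyhedral product, that of the set of proper
  faces, so the general facts about such colimits apply to it.\<close>

lemma wpp_data_unfold:
  assumes "finite \<sigma>"
  shows "wpp_data V P c \<sigma> =
    (let S = pp V P {\<tau>. \<tau> \<subset> \<sigma>}; g = eta_boundary V P c \<sigma> in
      (pushout (pp_simplex_top V P \<sigma>) (wpp V P c {\<tau>. \<tau> \<subset> \<sigma>}) S g,
       pushout_cell S g,
       (\<lambda>\<tau> y. if \<tau> = \<sigma> then y else pushout_old S g (wpp_in V P c {\<tau>. \<tau> \<subset> \<sigma>} \<tau> y))))"
proof -
  define D where "D \<tau> = (if finite \<sigma> \<and> \<tau> \<subset> \<sigma> then wpp_data V P c \<tau> else undefined)" for \<tau>
  have D: "D \<tau> = wpp_data V P c \<tau>" if "\<tau> \<subset> \<sigma>" for \<tau>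
    using that assms by (simp add: D_def)
  have "colim_in {\<tau>. \<tau> \<subset> \<sigma>} (\<lambda>\<tau>. fst (D \<tau>)) (\<lambda>\<delta> \<tau>. snd (snd (D \<tau>)) \<delta>) =
      wpp_in V P c {\<tau>. \<tau> \<subset> \<sigma>}"
    unfolding wpp_in_def by (rule colim_cong) (simp_all add: D wpp_simplex_def iota_simplex_def)
  moreover have "colim {\<tau>. \<tau> \<subset> \<sigma>} (\<lambda>\<tau>. fst (D \<tau>)) (\<lambda>\<delta> \<tau>. snd (snd (D \<tau>)) \<delta>) =
      wpp V P c {\<tau>. \<tau> \<subset> \<sigma>}"
    unfolding wpp_def by (rule colim_cong) (simp_all add: D wpp_simplex_def iota_simplex_def)
  moreover have "(THE y. \<forall>\<tau>\<in>{\<tau>. \<tau> \<subset> \<sigma>}. x \<in> pp_simplex V P \<tau> \<longrightarrow>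
      y = wpp_in V P c {\<tau>. \<tau> \<subset> \<sigma>} \<tau> (fst (snd (D \<tau>)) (power_map V P c \<sigma> \<tau> x))) =
      eta_boundary V P c \<sigma> x" for x
    unfolding eta_boundary_def eta_def
    by (intro arg_cong[where f=The] ext ball_cong refl) (simp add: D)
  moreover have "wpp_data V P c \<sigma> = wpp_step V P c \<sigma> D"
    unfolding D_def[abs_def] by (subst wpp_data.simps) (rule refl)
  ultimately show ?thesis
    by (simp only: wpp_step_def Let_def)
qed

lemma wpp_simplex_pushout:
  "finite \<sigma> \<Longrightarrow> wpp_simplex V P c \<sigma> =
     pushout (pp_simplex_top V P \<sigma>) (wpp V P c {\<tau>. \<tau> \<subset> \<sigma>})
       (pp V P {\<tau>. \<tau> \<subset> \<sigma>}) (eta_boundary V P c \<sigma>)"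
  by (simp add: wpp_simplex_def wpp_data_unfold Let_def)

lemma eta_pushout_cell:
  "finite \<sigma> \<Longrightarrow> eta V P c \<sigma> = pushout_cell (pp V P {\<tau>. \<tau> \<subset> \<sigma>}) (eta_boundary V P c \<sigma>)"
  by (simp add: eta_def wpp_data_unfold Let_def)

lemma iota_simplex_self: "finite \<sigma> \<Longrightarrow> iota_simplex V P c \<sigma> \<sigma> y = y"
  by (simp add: iota_simplex_def wpp_data_unfold Let_def)

lemma iota_simplex_pushout_old:
  "finite \<sigma> \<Longrightarrow> \<tau> \<subset> \<sigma> \<Longrightarrow> iota_simplex V P c \<tau> \<sigma> y =
     pushout_old (pp V P {\<tau>. \<tau> \<subset> \<sigma>}) (eta_boundary V P c \<sigma>) (wpp_in V P c {\<tau>. \<tau> \<subset> \<sigma>} \<tau> y)"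
  by (auto simp: iota_simplex_def wpp_data_unfold Let_def)

lemma wpp_in_iota_simplex:
  assumes "\<tau> \<in> K" "\<sigma> \<in> K" "\<tau> \<subseteq> \<sigma>" "y \<in> topspace (wpp_simplex V P c \<tau>)"
  shows "wpp_in V P c K \<sigma> (iota_simplex V P c \<tau> \<sigma> y) = wpp_in V P c K \<tau> y"
  unfolding wpp_in_def using assms by (rule colim_in_glue)

lemma continuous_map_wpp_in:
  "\<sigma> \<in> K \<Longrightarrow> continuous_map (wpp_simplex V P c \<sigma>) (wpp V P c K) (wpp_in V P c K \<sigma>)"
  unfolding wpp_in_def wpp_def by (rule continuous_map_colim_in)

lemma continuous_map_iota_simplex:
  assumes "finite \<sigma>" "\<tau> \<subseteq> \<sigma>"
  shows "continuous_map (wpp_simplex V P c \<tau>) (wpp_simplex V P c \<sigma>) (iota_simplex V P c \<tau> \<sigma>)"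
proof (cases "\<tau> = \<sigma>")
  case True
  show ?thesis
    unfolding True
    by (rule continuous_map_eq[OF continuous_map_id]) (use assms in \<open>simp add: iota_simplex_self\<close>)
next
  case False
  then have "\<tau> \<subset> \<sigma>"
    using assms by blast
  then have "iota_simplex V P c \<tau> \<sigma> =
      pushout_old (pp V P {\<tau>. \<tau> \<subset> \<sigma>}) (eta_boundary V P c \<sigma>) \<circ> wpp_in V P c {\<tau>. \<tau> \<subset> \<sigma>} \<tau>"
    using assms by (simp add: iota_simplex_pushout_old fun_eq_iff)
  then show ?thesis
    unfolding wpp_simplex_pushout[OF assms(1)] using \<open>\<tau> \<subset> \<sigma>\<close>
    by (simp only:)
      (rule continuous_map_compose[OF continuous_map_wpp_in continuous_map_pushout_old], simp)
qed

lemma iota_simplex_in_topspace: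
  "finite \<sigma> \<Longrightarrow> \<tau> \<subseteq> \<sigma> \<Longrightarrow> y \<in> topspace (wpp_simplex V P c \<tau>) \<Longrightarrow>
     iota_simplex V P c \<tau> \<sigma> y \<in> topspace (wpp_simplex V P c \<sigma>)"
  using continuous_map_image_subset_topspace[OF continuous_map_iota_simplex[of \<sigma> \<tau> V P c]]
  by blast

text \<open>If \<open>\<tau>\<close> is a proper face, both sides pass through the boundary of \<open>\<sigma>\<close>, in which \<open>\<delta>\<close> and
  \<open>\<tau>\<close> have been glued along the structure map between them.\<close>

lemma iota_simplex_trans:
  assumes "finite \<sigma>" "\<delta> \<subseteq> \<tau>" "\<tau> \<subseteq> \<sigma>" "y \<in> topspace (wpp_simplex V P c \<delta>)"
  shows "iota_simplex V P c \<tau> \<sigma> (iota_simplex V P c \<delta> \<tau> y) = iota_simplex V P c \<delta> \<sigma> y"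
proof -
  consider "\<tau> = \<sigma>" | "\<tau> \<subset> \<sigma>"
    using assms by blast
  then show ?thesis
  proof cases
    case 1
    then show ?thesis
      by (simp add: iota_simplex_self[OF assms(1)])
  next
    case 2
    then have "\<delta> \<subset> \<sigma>"
      using assms by blast
    with 2 show ?thesis
      unfolding iota_simplex_pushout_old[OF assms(1) 2]
        iota_simplex_pushout_old[OF assms(1) \<open>\<delta> \<subset> \<sigma>\<close>]
      using assms(2,4) by (subst wpp_in_iota_simplex) auto
  qed
qed

lemma topspace_pp_simplex_top: "topspace (pp_simplex_top V P \<sigma>) = pp_simplex V P \<sigma>"
  by (auto simp: pp_simplex_top_def k_product_def pp_simplex_def)

lemma continuous_map_eta:
  "finite \<sigma> \<Longrightarrow> continuous_map (pp_simplex_top V P \<sigma>) (wpp_simplex V P c \<sigma>) (eta V P c \<sigma>)"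
  by (simp add: wpp_simplex_pushout[of \<sigma>] eta_pushout_cell[of \<sigma>] continuous_map_pushout_cell)

lemma eta_in_topspace:
  "finite \<sigma> \<Longrightarrow> x \<in> pp_simplex V P \<sigma> \<Longrightarrow> eta V P c \<sigma> x \<in> topspace (wpp_simplex V P c \<sigma>)"
  using continuous_map_image_subset_topspace[OF continuous_map_eta[of \<sigma> V P c]]
  unfolding topspace_pp_simplex_top by blast

lemma topspace_wpp: "topspace (wpp V P c K) =
    (\<Union>\<sigma>\<in>K. wpp_in V P c K \<sigma> ` topspace (wpp_simplex V P c \<sigma>))"
  by (simp add: wpp_def wpp_in_def topspace_colim)

text \<open>Maps out of a weighted simplex are therefore determined by their composites with \<open>\<eta>\<close> and
  with the structure maps from the proper faces.\<close>

lemma wpp_simplex_cases: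
  assumes "finite \<sigma>" "y \<in> topspace (wpp_simplex V P c \<sigma>)"
  obtains (cell) x where "x \<in> pp_simplex V P \<sigma>" "y = eta V P c \<sigma> x"
  | (face) \<delta> w where "\<delta> \<subset> \<sigma>" "w \<in> topspace (wpp_simplex V P c \<delta>)" "y = iota_simplex V P c \<delta> \<sigma> w"
  using assms(2) unfolding wpp_simplex_pushout[OF assms(1)] topspace_pushout topspace_wpp
  by (auto simp: topspace_pp_simplex_top eta_pushout_cell[OF assms(1)]
      iota_simplex_pushout_old[OF assms(1)])

lemma continuous_map_from_wpp_simplex:
  assumes "finite \<sigma>"
    and "continuous_map (pp_simplex_top V P \<sigma>) Y (\<lambda>x. h (eta V P c \<sigma> x))"
    and "\<And>\<delta>. \<delta> \<subset> \<sigma> \<Longrightarrow> continuous_map (wpp_simplex V P c \<delta>) Y (\<lambda>w. h (iota_simplex V P c \<delta> \<sigma> w))"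
  shows "continuous_map (wpp_simplex V P c \<sigma>) Y h"
  unfolding wpp_simplex_pushout[OF assms(1)]
proof (rule continuous_map_from_pushout)
  let ?old = "pushout_old (pp V P {\<tau>. \<tau> \<subset> \<sigma>}) (eta_boundary V P c \<sigma>)"
  show "continuous_map (wpp V P c {\<tau>. \<tau> \<subset> \<sigma>}) Y (\<lambda>y. h (?old y))"
    unfolding wpp_def
  proof (rule continuous_map_from_colim)
    fix \<delta> assume "\<delta> \<in> {\<tau>. \<tau> \<subset> \<sigma>}"
    then have \<delta>: "\<delta> \<subset> \<sigma>"
      by blast
    show "continuous_map (wpp_simplex V P c \<delta>) Y
        (\<lambda>w. h (?old (colim_in {\<tau>. \<tau> \<subset> \<sigma>} (wpp_simplex V P c) (iota_simplex V P c) \<delta> w)))"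
      using assms(3)[OF \<delta>]
      unfolding iota_simplex_pushout_old[OF assms(1) \<delta>] by (simp only: wpp_in_def)
  qed
  show "continuous_map (pp_simplex_top V P \<sigma>) Y
      (\<lambda>x. h (pushout_cell (pp V P {\<tau>. \<tau> \<subset> \<sigma>}) (eta_boundary V P c \<sigma>) x))"
    using assms(2) unfolding eta_pushout_cell[OF assms(1)] .
qed

section \<open>Weighted simplices of power couples\<close>

locale power_couple_sequence =
  fixes P :: "nat \<Rightarrow> 'a couple" and m :: nat and c :: "nat set \<Rightarrow> nat \<Rightarrow> nat"
  assumes power_couple: "i \<in> {1..m} \<Longrightarrow> power_couple (P i)"
    and power_sequence: "power_sequence m c"
begin

lemma exponent_pos:
  assumes "\<tau> \<subseteq> \<sigma>" "\<sigma> \<subseteq> {1..m}" "i \<in> {1..m}"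
  shows "c \<sigma> i div c \<tau> i \<ge> 1"
proof -
  have "c \<tau> i dvd c \<sigma> i" "c \<sigma> i \<ge> 1"
    using power_sequence assms by (auto simp: power_sequence_def)
  then show ?thesis
    by (auto simp: dvd_def)
qed

lemma exponent_mult:
  assumes "\<delta> \<subseteq> \<tau>" "\<tau> \<subseteq> \<sigma>" "\<sigma> \<subseteq> {1..m}" "i \<in> {1..m}"
  shows "(c \<tau> i div c \<delta> i) * (c \<sigma> i div c \<tau> i) = c \<sigma> i div c \<delta> i"
proof -
  have "c \<tau> i dvd c \<sigma> i" "c \<delta> i dvd c \<tau> i" "c \<sigma> i \<ge> 1"
    using power_sequence assms by (auto simp: power_sequence_def)
  then show ?thesis
    by (auto simp: dvd_def)
qed

lemma power_map_in_pp_simplex: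
  assumes "V \<subseteq> {1..m}" "\<tau> \<subseteq> \<sigma>" "\<sigma> \<subseteq> {1..m}" "x \<in> pp_simplex V P \<delta>"
  shows "power_map V P c \<sigma> \<tau> x \<in> pp_simplex V P \<delta>"
proof -
  have "rho (P i) (c \<sigma> i div c \<tau> i) ` topspace (total (P i)) \<subseteq> topspace (total (P i))"
    "rho (P i) (c \<sigma> i div c \<tau> i) ` part (P i) \<subseteq> part (P i)" if "i \<in> V" for i
    using power_couple[of i] exponent_pos[of \<tau> \<sigma> i] assms that
    unfolding power_couple_def continuous_map_def by blast+
  then show ?thesis
    using assms(4) by (fastforce simp: pp_simplex_def power_map_def PiE_iff)
qed

text \<open>Lying in any \<open>pp_simplex V P \<kappa>\<close> places the coordinates of \<open>x\<close> in the total spaces, where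
  \<open>\<rho>\<^sub>a \<circ> \<rho>\<^sub>b = \<rho>\<^sub>a\<^sub>b\<close> is available.\<close>

lemma power_map_comp:
  assumes "V \<subseteq> {1..m}" "\<delta> \<subseteq> \<tau>" "\<tau> \<subseteq> \<sigma>" "\<sigma> \<subseteq> {1..m}" "x \<in> pp_simplex V P \<kappa>"
  shows "power_map V P c \<tau> \<delta> (power_map V P c \<sigma> \<tau> x) = power_map V P c \<sigma> \<delta> x"
proof (rule ext)
  fix i
  show "power_map V P c \<tau> \<delta> (power_map V P c \<sigma> \<tau> x) i = power_map V P c \<sigma> \<delta> x i"
  proof (cases "i \<in> V")
    case True
    then have i: "i \<in> {1..m}" "x i \<in> topspace (total (P i))"
      using assms by (auto simp: pp_simplex_def)
    moreover have "c \<tau> i div c \<delta> i \<ge> 1" "c \<sigma> i div c \<tau> i \<ge> 1"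
      using exponent_pos[of \<delta> \<tau> i] exponent_pos[of \<tau> \<sigma> i] i assms by auto
    ultimately show ?thesis
      using True power_couple[of i] exponent_mult[of \<delta> \<tau> \<sigma> i] assms
      by (simp add: power_map_def power_couple_def)
  qed (simp add: power_map_def)
qed

lemma power_map_self:
  assumes "V \<subseteq> {1..m}" "\<sigma> \<subseteq> {1..m}" "x \<in> pp_simplex V P \<kappa>"
  shows "power_map V P c \<sigma> \<sigma> x = x"
proof (rule ext)
  fix i
  show "power_map V P c \<sigma> \<sigma> x i = x i"
  proof (cases "i \<in> V")
    case True
    then have "i \<in> {1..m}" "x i \<in> topspace (total (P i))"
      using assms by (auto simp: pp_simplex_def)
    moreover from this have "c \<sigma> i \<ge> 1"
      using power_sequence assms by (auto simp: power_sequence_def)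
    ultimately show ?thesis
      using True power_couple[of i] by (simp add: power_map_def power_couple_def)
  qed (use assms in \<open>auto simp: power_map_def pp_simplex_def\<close>)
qed

text \<open>The values prescribed on \<open>\<tau>\<close> and \<open>\<tau>'\<close> at a common point both equal the value prescribed
  on \<open>\<tau> \<inter> \<tau>'\<close>, by compatibility of \<open>\<eta>\<close> with faces strictly below \<open>\<sigma>\<close>. That
  compatibility is a hypothesis because it is established by the induction that uses this lemma.\<close>

lemma eta_boundary_eq_if_eta_face:
  assumes V: "V \<subseteq> {1..m}" and \<sigma>: "\<sigma> \<subseteq> {1..m}"
    and eta_face: "\<And>\<delta> \<tau> x. \<delta> \<subseteq> \<tau> \<Longrightarrow> \<tau> \<subset> \<sigma> \<Longrightarrow> x \<in> pp_simplex V P \<delta> \<Longrightarrow>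
      eta V P c \<tau> x = iota_simplex V P c \<delta> \<tau> (eta V P c \<delta> (power_map V P c \<tau> \<delta> x))"
    and \<tau>: "\<tau> \<subset> \<sigma>" and x: "x \<in> pp_simplex V P \<tau>"
  shows "eta_boundary V P c \<sigma> x =
    wpp_in V P c {\<tau>. \<tau> \<subset> \<sigma>} \<tau> (eta V P c \<tau> (power_map V P c \<sigma> \<tau> x))"
proof -
  let ?in = "\<lambda>\<tau>. wpp_in V P c {\<tau>. \<tau> \<subset> \<sigma>} \<tau> (eta V P c \<tau> (power_map V P c \<sigma> \<tau> x))"
  have fin: "finite \<sigma>"
    by (rule finite_subset[OF \<sigma>]) simp
  have face: "?in \<delta> = ?in \<tau>" if "\<delta> \<subseteq> \<tau>" "\<tau> \<subset> \<sigma>" "x \<in> pp_simplex V P \<delta>" for \<delta> \<tau>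
  proof -
    have \<delta>: "\<delta> \<subset> \<sigma>"
      using that(1,2) by blast
    then have \<delta>_fin: "finite \<delta>"
      by (intro finite_subset[OF _ fin]) blast
    have in_\<delta>: "power_map V P c \<sigma> \<delta> x \<in> pp_simplex V P \<delta>"
      "power_map V P c \<sigma> \<tau> x \<in> pp_simplex V P \<delta>"
      using power_map_in_pp_simplex[OF V _ \<sigma> that(3)] \<delta> that(2) by blast+
    have "\<tau> \<subseteq> \<sigma>"
      using that(2) by blast
    have "eta V P c \<tau> (power_map V P c \<sigma> \<tau> x) =
        iota_simplex V P c \<delta> \<tau> (eta V P c \<delta> (power_map V P c \<sigma> \<delta> x))"
      using eta_face[OF that(1,2) in_\<delta>(2)]
      unfolding power_map_comp[OF V that(1) \<open>\<tau> \<subseteq> \<sigma>\<close> \<sigma> that(3)] .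
    moreover have "\<delta> \<in> {\<tau>. \<tau> \<subset> \<sigma>}" "\<tau> \<in> {\<tau>. \<tau> \<subset> \<sigma>}"
      using that(2) \<delta> by simp_all
    ultimately show ?thesis
      using wpp_in_iota_simplex[OF _ _ that(1) eta_in_topspace[OF \<delta>_fin in_\<delta>(1)]]
      by (simp only:)
  qed
  have unique: "?in \<tau>' = ?in \<tau>" if "\<tau>' \<subset> \<sigma>" "x \<in> pp_simplex V P \<tau>'" for \<tau>'
  proof -
    have "x \<in> pp_simplex V P (\<tau> \<inter> \<tau>')"
      using x that by (auto simp: pp_simplex_def)
    then have "?in (\<tau> \<inter> \<tau>') = ?in \<tau>" "?in (\<tau> \<inter> \<tau>') = ?in \<tau>'"
      by (rule face[OF Int_lower1 \<tau>], rule face[OF Int_lower2 that(1)])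
    then show ?thesis
      by (simp only:)
  qed
  show ?thesis
    unfolding eta_boundary_def
  proof (rule the_equality)
    show "\<forall>\<tau>'\<in>{\<tau>. \<tau> \<subset> \<sigma>}. x \<in> pp_simplex V P \<tau>' \<longrightarrow> ?in \<tau> = ?in \<tau>'"
      by (intro ballI impI unique[symmetric]) simp_all
    show "y = ?in \<tau>" if "\<forall>\<tau>\<in>{\<tau>. \<tau> \<subset> \<sigma>}. x \<in> pp_simplex V P \<tau> \<longrightarrow> y = ?in \<tau>" for y
      using bspec[OF that, of \<tau>] \<tau> x by simp
  qed
qed

text \<open>The gluing at \<open>\<sigma>\<close> identifies a boundary point of the cell with its image under
  \<open>\<eta>(\<partial>\<sigma>)\<close>, whose value on the face \<open>\<tau>\<close> is the one claimed once \<open>\<eta>(\<partial>\<sigma>)\<close> is known to be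
  well defined; the induction hypothesis provides that.\<close>

lemma eta_face:
  assumes "V \<subseteq> {1..m}" "\<sigma> \<subseteq> {1..m}" "\<tau> \<subseteq> \<sigma>" "x \<in> pp_simplex V P \<tau>"
  shows "eta V P c \<sigma> x = iota_simplex V P c \<tau> \<sigma> (eta V P c \<tau> (power_map V P c \<sigma> \<tau> x))"
proof -
  have "finite \<sigma>"
    by (rule finite_subset[OF assms(2)]) simp
  then show ?thesis
    using assms
  proof (induction \<sigma> arbitrary: \<tau> x rule: finite_psubset_induct)
    case (psubset \<sigma>)
    show ?case
    proof (cases "\<tau> = \<sigma>")
      case True
      then show ?thesis
        using psubset.prems by (simp add: power_map_self iota_simplex_self[OF psubset.hyps])
    next
      case False
      then have \<tau>: "\<tau> \<subset> \<sigma>"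
        using psubset.prems by blast
      have "eta_boundary V P c \<sigma> x =
          wpp_in V P c {\<tau>. \<tau> \<subset> \<sigma>} \<tau> (eta V P c \<tau> (power_map V P c \<sigma> \<tau> x))"
      proof (rule eta_boundary_eq_if_eta_face[OF psubset.prems(1,2) _ \<tau> psubset.prems(4)])
        fix \<delta> \<tau>' y
        assume "\<delta> \<subseteq> \<tau>'" "\<tau>' \<subset> \<sigma>" "y \<in> pp_simplex V P \<delta>"
        moreover from this have "\<tau>' \<subseteq> {1..m}"
          using psubset.prems(2) by blast
        ultimately show "eta V P c \<tau>' y =
            iota_simplex V P c \<delta> \<tau>' (eta V P c \<delta> (power_map V P c \<tau>' \<delta> y))"
          using psubset.prems(1) by (intro psubset.IH)
      qed
      moreover have "x \<in> pp V P {\<tau>. \<tau> \<subset> \<sigma>}"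
        unfolding pp_def using \<tau> psubset.prems(4) by (intro UN_I) simp_all
      ultimately show ?thesis
        unfolding eta_pushout_cell[OF psubset.hyps] iota_simplex_pushout_old[OF psubset.hyps \<tau>]
        by (simp only: pushout_glue)
    qed
  qed
qed

lemma eta_boundary_eq:
  assumes "V \<subseteq> {1..m}" "\<sigma> \<subseteq> {1..m}" "\<tau> \<subset> \<sigma>" "x \<in> pp_simplex V P \<tau>"
  shows "eta_boundary V P c \<sigma> x =
    wpp_in V P c {\<tau>. \<tau> \<subset> \<sigma>} \<tau> (eta V P c \<tau> (power_map V P c \<sigma> \<tau> x))"
proof (rule eta_boundary_eq_if_eta_face[OF assms(1,2) _ assms(3,4)])
  fix \<delta> \<tau>' y
  assume "\<delta> \<subseteq> \<tau>'" "\<tau>' \<subset> \<sigma>" "y \<in> pp_simplex V P \<delta>"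
  then show "eta V P c \<tau>' y = iota_simplex V P c \<delta> \<tau>' (eta V P c \<delta> (power_map V P c \<tau>' \<delta> y))"
    using assms(1,2) by (intro eta_face) auto
qed

text \<open>The universal property of the underlying set of a weighted simplex: first descend to the
  boundary, then to the pushout.\<close>

lemma wpp_simplex_universal:
  assumes V: "V \<subseteq> {1..m}" and \<sigma>: "\<sigma> \<subseteq> {1..m}"
    and face: "\<And>\<delta> \<tau> w. \<delta> \<subseteq> \<tau> \<Longrightarrow> \<tau> \<subset> \<sigma> \<Longrightarrow> w \<in> topspace (wpp_simplex V P c \<delta>) \<Longrightarrow>
      g \<tau> (iota_simplex V P c \<delta> \<tau> w) = g \<delta> w"
    and cell: "\<And>\<delta> x. \<delta> \<subset> \<sigma> \<Longrightarrow> x \<in> pp_simplex V P \<delta> \<Longrightarrow>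
      g \<delta> (eta V P c \<delta> (power_map V P c \<sigma> \<delta> x)) = e x"
  obtains h where "\<And>x. h (eta V P c \<sigma> x) = e x"
    and "\<And>\<delta> w. \<delta> \<subset> \<sigma> \<Longrightarrow> h (iota_simplex V P c \<delta> \<sigma> w) = g \<delta> w"
proof -
  have fin: "finite \<sigma>"
    by (rule finite_subset[OF \<sigma>]) simp
  obtain b where b: "\<And>\<delta> w. b (wpp_in V P c {\<tau>. \<tau> \<subset> \<sigma>} \<delta> w) = g \<delta> w"
    unfolding wpp_in_def
    using colim_universal[of "{\<tau>. \<tau> \<subset> \<sigma>}" "wpp_simplex V P c" g "iota_simplex V P c"] face
    by blast
  have "e x = b (eta_boundary V P c \<sigma> x)" if "x \<in> pp V P {\<tau>. \<tau> \<subset> \<sigma>}" for x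
  proof -
    from that obtain \<delta> where "\<delta> \<subset> \<sigma>" "x \<in> pp_simplex V P \<delta>"
      by (auto simp: pp_def)
    then show ?thesis
      by (simp only: eta_boundary_eq[OF V \<sigma>] b cell)
  qed
  then obtain h where h:
    "\<And>x. h (pushout_cell (pp V P {\<tau>. \<tau> \<subset> \<sigma>}) (eta_boundary V P c \<sigma>) x) = e x"
    "\<And>y. h (pushout_old (pp V P {\<tau>. \<tau> \<subset> \<sigma>}) (eta_boundary V P c \<sigma>) y) = b y"
    using pushout_universal[of "pp V P {\<tau>. \<tau> \<subset> \<sigma>}" e b "eta_boundary V P c \<sigma>"] by blast
  then show ?thesis
    by (intro that[of h]) (simp_all only: eta_pushout_cell[OF fin] iota_simplex_pushout_old[OF fin] h b)
qed

section \<open>Projections of weighted simplices\<close>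

lemma restrict_in_pp_simplex:
  "I \<subseteq> V \<Longrightarrow> x \<in> pp_simplex V P \<tau> \<Longrightarrow> restrict x I \<in> pp_simplex I P (\<tau> \<inter> I)"
  by (auto simp: pp_simplex_def PiE_iff)

lemma restrict_power_map:
  "I \<subseteq> V \<Longrightarrow> restrict (power_map V P c \<sigma> \<tau> x) I = power_map I P c \<sigma> \<tau> (restrict x I)"
  by (auto simp: power_map_def fun_eq_iff)

text \<open>The map is continuous for the product topologies, and kification is a functor; it is
  applied once for the product and once more for the subspace.\<close>

lemma continuous_map_project_cell:
  assumes "V \<subseteq> {1..m}" "I \<subseteq> V" "\<tau> \<subseteq> {1..m}"
  shows "continuous_map (pp_simplex_top V P \<tau>) (pp_simplex_top I P (\<tau> \<inter> I))
    (\<lambda>x. power_map I P c \<tau> (\<tau> \<inter> I) (restrict x I))"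
proof -
  let ?f = "\<lambda>x. power_map I P c \<tau> (\<tau> \<inter> I) (restrict x I)"
  have f: "?f x = (\<lambda>i\<in>I. rho (P i) (c \<tau> i div c (\<tau> \<inter> I) i) (x i))" for x
    by (auto simp: power_map_def)
  have rho: "continuous_map (total (P i)) (total (P i)) (rho (P i) (c \<tau> i div c (\<tau> \<inter> I) i))"
    if "i \<in> I" for i
    using power_couple[of i] exponent_pos[of "\<tau> \<inter> I" \<tau> i] assms that
    by (auto simp: power_couple_def)
  have "continuous_map (product_topology (\<lambda>i. total (P i)) V) (product_topology (\<lambda>i. total (P i)) I) ?f"
    unfolding f continuous_map_componentwise
  proof (intro conjI ballI)
    fix i assume "i \<in> I"
    then have "continuous_map (product_topology (\<lambda>i. total (P i)) V) (total (P i)) (\<lambda>x. x i)"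
      using assms by (intro continuous_map_product_projection) auto
    from continuous_map_compose[OF this rho[OF \<open>i \<in> I\<close>]] \<open>i \<in> I\<close>
    show "continuous_map (product_topology (\<lambda>i. total (P i)) V) (total (P i))
        (\<lambda>x. (\<lambda>i\<in>I. rho (P i) (c \<tau> i div c (\<tau> \<inter> I) i) (x i)) i)"
      by (simp add: o_def)
  qed auto
  then have "continuous_map (k_product V P) (k_product I P) ?f"
    unfolding k_product_def by (rule continuous_map_kification)
  moreover have "?f ` pp_simplex V P \<tau> \<subseteq> pp_simplex I P (\<tau> \<inter> I)"
    using power_map_in_pp_simplex[of I "\<tau> \<inter> I" \<tau>] restrict_in_pp_simplex assms by auto
  ultimately have "continuous_map (subtopology (k_product V P) (pp_simplex V P \<tau>))
      (subtopology (k_product I P) (pp_simplex I P (\<tau> \<inter> I))) ?f"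
    by (auto simp: continuous_map_in_subtopology continuous_map_from_subtopology)
  then show ?thesis
    unfolding pp_simplex_top_def by (rule continuous_map_kification)
qed

text \<open>All three assertions are proved in one induction. Those about lower faces feed
  the compatibility of the values prescribed at \<open>\<tau>\<close>, and their continuity also ensures that a
  projected point lies in the weighted simplex on \<open>I\<close>, where the structure maps compose.\<close>

lemma wproj_simplex_correct:
  assumes "V \<subseteq> {1..m}" "I \<subseteq> V" "\<tau> \<subseteq> {1..m}"
  shows "(\<forall>x\<in>pp_simplex V P \<tau>. wproj_simplex V I P c \<tau> (eta V P c \<tau> x) =
          eta I P c (\<tau> \<inter> I) (power_map I P c \<tau> (\<tau> \<inter> I) (restrict x I))) \<and>
    (\<forall>\<delta>. \<delta> \<subset> \<tau> \<longrightarrow> (\<forall>w\<in>topspace (wpp_simplex V P c \<delta>).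
        wproj_simplex V I P c \<tau> (iota_simplex V P c \<delta> \<tau> w) =
          iota_simplex I P c (\<delta> \<inter> I) (\<tau> \<inter> I) (wproj_simplex V I P c \<delta> w))) \<and>
    continuous_map (wpp_simplex V P c \<tau>) (wpp_simplex I P c (\<tau> \<inter> I)) (wproj_simplex V I P c \<tau>)"
proof -
  let ?p = "wproj_simplex V I P c" and ?e = "\<lambda>\<tau> x. power_map I P c \<tau> (\<tau> \<inter> I) (restrict x I)"
  have "finite \<tau>"
    by (rule finite_subset[OF assms(3)]) simp
  then show ?thesis
    using assms(3)
  proof (induction \<tau> rule: finite_psubset_induct)
    case (psubset \<tau>)
    note fin = \<open>finite \<tau>\<close> and \<tau> = \<open>\<tau> \<subseteq> {1..m}\<close>
    have IH_eta: "?p \<delta> (eta V P c \<delta> x) = eta I P c (\<delta> \<inter> I) (?e \<delta> x)"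
      if "\<delta> \<subset> \<tau>" "x \<in> pp_simplex V P \<delta>" for \<delta> x
      using psubset.IH[OF that(1)] that \<tau> by blast
    have IH_iota: "?p \<tau>' (iota_simplex V P c \<delta> \<tau>' w) = iota_simplex I P c (\<delta> \<inter> I) (\<tau>' \<inter> I) (?p \<delta> w)"
      if "\<tau>' \<subset> \<tau>" "\<delta> \<subset> \<tau>'" "w \<in> topspace (wpp_simplex V P c \<delta>)" for \<delta> \<tau>' w
      using psubset.IH[OF that(1)] that \<tau> by blast
    have IH_cont: "continuous_map (wpp_simplex V P c \<delta>) (wpp_simplex I P c (\<delta> \<inter> I)) (?p \<delta>)"
      if "\<delta> \<subset> \<tau>" for \<delta>
      using psubset.IH[OF that] that \<tau> by blast
    obtain h where h_eta: "\<And>x. h (eta V P c \<tau> x) = eta I P c (\<tau> \<inter> I) (?e \<tau> x)"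
      and h_iota: "\<And>\<delta> w. \<delta> \<subset> \<tau> \<Longrightarrow>
        h (iota_simplex V P c \<delta> \<tau> w) = iota_simplex I P c (\<delta> \<inter> I) (\<tau> \<inter> I) (?p \<delta> w)"
    proof (rule wpp_simplex_universal[OF assms(1) \<tau>,
          of "\<lambda>\<delta> w. iota_simplex I P c (\<delta> \<inter> I) (\<tau> \<inter> I) (?p \<delta> w)" "\<lambda>x. eta I P c (\<tau> \<inter> I) (?e \<tau> x)"])
      fix \<delta> \<tau>' w
      assume \<delta>: "\<delta> \<subseteq> \<tau>'" "\<tau>' \<subset> \<tau>" "w \<in> topspace (wpp_simplex V P c \<delta>)"
      have fin': "finite \<tau>'"
        using \<delta>(2) by (intro finite_subset[OF _ fin]) blast
      show "iota_simplex I P c (\<tau>' \<inter> I) (\<tau> \<inter> I) (?p \<tau>' (iota_simplex V P c \<delta> \<tau>' w)) =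
          iota_simplex I P c (\<delta> \<inter> I) (\<tau> \<inter> I) (?p \<delta> w)"
        \<comment> \<open>The induction hypothesis covers proper faces only.\<close>
      proof (cases "\<delta> = \<tau>'")
        case True
        then show ?thesis
          using fin' by (simp add: iota_simplex_self)
      next
        case False
        have "\<delta> \<subset> \<tau>'" "\<delta> \<subset> \<tau>"
          using \<delta> False by blast+
        moreover have "?p \<delta> w \<in> topspace (wpp_simplex I P c (\<delta> \<inter> I))"
          using continuous_map_image_subset_topspace[OF IH_cont[OF \<open>\<delta> \<subset> \<tau>\<close>]] \<delta>(3) by blast
        moreover have "\<delta> \<inter> I \<subseteq> \<tau>' \<inter> I" "\<tau>' \<inter> I \<subseteq> \<tau> \<inter> I"
          using \<delta> by auto
        ultimately show ?thesis
          using IH_iota[OF \<delta>(2) _ \<delta>(3)] fin by (simp add: iota_simplex_trans)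
      qed
    next
      fix \<delta> x
      assume \<delta>: "\<delta> \<subset> \<tau>" "x \<in> pp_simplex V P \<delta>"
      then have sub: "\<delta> \<inter> I \<subseteq> \<tau> \<inter> I" "\<delta> \<subseteq> \<tau>" "\<tau> \<inter> I \<subseteq> {1..m}" "I \<subseteq> {1..m}"
        using \<tau> assms by auto
      have xI: "restrict x I \<in> pp_simplex I P (\<delta> \<inter> I)"
        using \<delta> assms by (simp add: restrict_in_pp_simplex)
      \<comment> \<open>Both routes from \<open>\<tau>\<close> down to \<open>\<delta> \<inter> I\<close>, through \<open>\<delta>\<close> and through \<open>\<tau> \<inter> I\<close>, have the
        same total exponents.\<close>
      have "?p \<delta> (eta V P c \<delta> (power_map V P c \<tau> \<delta> x)) =
          eta I P c (\<delta> \<inter> I) (?e \<delta> (power_map V P c \<tau> \<delta> x))"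
        using \<delta> sub \<tau> assms by (intro IH_eta power_map_in_pp_simplex) auto
      also have "?e \<delta> (power_map V P c \<tau> \<delta> x) = power_map I P c \<tau> (\<delta> \<inter> I) (restrict x I)"
        unfolding restrict_power_map[OF assms(2)]
        using sub \<tau> xI by (intro power_map_comp) auto
      also have "\<dots> = power_map I P c (\<tau> \<inter> I) (\<delta> \<inter> I) (?e \<tau> x)"
        using sub \<tau> xI by (intro power_map_comp[symmetric]) auto
      finally show "iota_simplex I P c (\<delta> \<inter> I) (\<tau> \<inter> I) (?p \<delta> (eta V P c \<delta> (power_map V P c \<tau> \<delta> x))) =
          eta I P c (\<tau> \<inter> I) (?e \<tau> x)"
        using eta_face[of I "\<tau> \<inter> I" "\<delta> \<inter> I" "?e \<tau> x"] sub \<tau> xI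
          power_map_in_pp_simplex[of I "\<tau> \<inter> I" \<tau> "restrict x I" "\<delta> \<inter> I"] by simp
    qed blast
    have p_eq_h: "?p \<tau> y = h y" if "y \<in> topspace (wpp_simplex V P c \<tau>)" for y
      unfolding wproj_simplex.simps[of V I P c \<tau> y]
    proof (rule the_equality)
      show "(\<forall>x\<in>pp_simplex V P \<tau>. eta V P c \<tau> x = y \<longrightarrow> h y = eta I P c (\<tau> \<inter> I) (?e \<tau> x)) \<and>
        (\<forall>\<delta>. finite \<tau> \<and> \<delta> \<subset> \<tau> \<longrightarrow> (\<forall>w\<in>topspace (wpp_simplex V P c \<delta>).
          iota_simplex V P c \<delta> \<tau> w = y \<longrightarrow>
            h y = iota_simplex I P c (\<delta> \<inter> I) (\<tau> \<inter> I) (?p \<delta> w)))"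
        using h_eta h_iota by auto
    next
      fix z
      assume "(\<forall>x\<in>pp_simplex V P \<tau>. eta V P c \<tau> x = y \<longrightarrow> z = eta I P c (\<tau> \<inter> I) (?e \<tau> x)) \<and>
        (\<forall>\<delta>. finite \<tau> \<and> \<delta> \<subset> \<tau> \<longrightarrow> (\<forall>w\<in>topspace (wpp_simplex V P c \<delta>).
          iota_simplex V P c \<delta> \<tau> w = y \<longrightarrow>
            z = iota_simplex I P c (\<delta> \<inter> I) (\<tau> \<inter> I) (?p \<delta> w)))"
      with that fin show "z = h y"
        by (cases rule: wpp_simplex_cases[OF fin that]) (auto simp: h_eta h_iota)
    qed
    have "continuous_map (wpp_simplex V P c \<tau>) (wpp_simplex I P c (\<tau> \<inter> I)) h"
    proof (rule continuous_map_from_wpp_simplex[OF fin])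
      show "continuous_map (pp_simplex_top V P \<tau>) (wpp_simplex I P c (\<tau> \<inter> I)) (\<lambda>x. h (eta V P c \<tau> x))"
        unfolding h_eta
        using continuous_map_compose[OF continuous_map_project_cell[OF assms(1,2) \<tau>]
            continuous_map_eta[of "\<tau> \<inter> I" I P c]] fin by (simp add: o_def)
      fix \<delta> assume \<delta>: "\<delta> \<subset> \<tau>"
      then have "\<delta> \<inter> I \<subseteq> \<tau> \<inter> I"
        by auto
      then show "continuous_map (wpp_simplex V P c \<delta>) (wpp_simplex I P c (\<tau> \<inter> I))
          (\<lambda>w. h (iota_simplex V P c \<delta> \<tau> w))"
        unfolding h_iota[OF \<delta>]
        using continuous_map_compose[OF IH_cont[OF \<delta>]
            continuous_map_iota_simplex[of "\<tau> \<inter> I" "\<delta> \<inter> I" I P c]] fin by (simp add: o_def)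
    qed
    then have "continuous_map (wpp_simplex V P c \<tau>) (wpp_simplex I P c (\<tau> \<inter> I)) (?p \<tau>)"
      by (rule continuous_map_eq) (simp add: p_eq_h)
    then show ?case
      by (intro conjI ballI allI impI)
        (simp_all only: h_eta h_iota p_eq_h eta_in_topspace[OF fin]
          iota_simplex_in_topspace[OF fin psubset_imp_subset])
  qed
qed

lemma wproj_simplex_eta:
  assumes "V \<subseteq> {1..m}" "I \<subseteq> V" "\<tau> \<subseteq> {1..m}" "x \<in> pp_simplex V P \<tau>"
  shows "wproj_simplex V I P c \<tau> (eta V P c \<tau> x) =
    eta I P c (\<tau> \<inter> I) (power_map I P c \<tau> (\<tau> \<inter> I) (restrict x I))"
  using wproj_simplex_correct assms by blast

lemma continuous_map_wproj_simplex:
  assumes "V \<subseteq> {1..m}" "I \<subseteq> V" "\<tau> \<subseteq> {1..m}"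
  shows "continuous_map (wpp_simplex V P c \<tau>) (wpp_simplex I P c (\<tau> \<inter> I)) (wproj_simplex V I P c \<tau>)"
  using wproj_simplex_correct assms by blast

lemma wproj_simplex_iota_simplex:
  assumes "V \<subseteq> {1..m}" "I \<subseteq> V" "\<tau> \<subseteq> {1..m}" "\<delta> \<subseteq> \<tau>" "w \<in> topspace (wpp_simplex V P c \<delta>)"
  shows "wproj_simplex V I P c \<tau> (iota_simplex V P c \<delta> \<tau> w) =
    iota_simplex I P c (\<delta> \<inter> I) (\<tau> \<inter> I) (wproj_simplex V I P c \<delta> w)"
proof (cases "\<delta> = \<tau>")
  case True
  then show ?thesis
    using finite_subset[OF assms(3)] by (simp add: iota_simplex_self)
next
  case False
  then show ?thesis
    using wproj_simplex_correct[OF assms(1-3)] assms(4,5) by blast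
qed

end

section \<open>Induced maps of colimits\<close>

lemma iota_wpp_in:
  assumes "L \<subseteq> K" "\<tau> \<in> L" "w \<in> topspace (wpp_simplex V P c \<tau>)"
  shows "iota V P c L K (wpp_in V P c L \<tau> w) = wpp_in V P c K \<tau> w"
  unfolding iota_def wpp_in_def[of V P c L]
  by (rule colim_desc_in) (use assms in \<open>auto intro!: wpp_in_iota_simplex\<close>)

lemma continuous_map_iota:
  assumes "L \<subseteq> K"
  shows "continuous_map (wpp V P c L) (wpp V P c K) (iota V P c L K)"
  unfolding iota_def wpp_def[of V P c L]
  by (rule continuous_map_colim_desc)
    (use assms in \<open>auto intro!: wpp_in_iota_simplex continuous_map_wpp_in\<close>)

lemma basept_in_pp_simplex:
  assumes "\<And>i. i \<in> V \<Longrightarrow> power_couple (P i)"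
  shows "(\<lambda>i\<in>V. basept (P i)) \<in> pp_simplex V P {}"
proof -
  have "basept (P i) \<in> part (P i)" "basept (P i) \<in> topspace (total (P i))" if "i \<in> V" for i
    using assms[OF that] unfolding power_couple_def by blast+
  then show ?thesis
    by (simp add: pp_simplex_def)
qed

lemma iota_wpp_basept:
  assumes "L \<subseteq> K" "{} \<in> L" "\<And>i. i \<in> V \<Longrightarrow> power_couple (P i)"
  shows "iota V P c L K (wpp_basept V P c L) = wpp_basept V P c K"
  using assms(1,2) basept_in_pp_simplex[OF assms(3)]
  by (simp add: wpp_basept_def iota_wpp_in eta_in_topspace)

lemma inter_in_full_subcomplex:
  "abs_simplicial_complex V K \<Longrightarrow> \<tau> \<in> K \<Longrightarrow> \<tau> \<inter> I \<in> full_subcomplex K I"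
  by (auto simp: abs_simplicial_complex_def full_subcomplex_def)

context power_couple_sequence
begin

text \<open>The colimit over the full subcomplex identifies points along the structure maps from
  \<open>\<delta> \<inter> I\<close> to \<open>\<tau> \<inter> I\<close>, with which the projections commute.\<close>

lemma wproj_compatible:
  assumes "abs_simplicial_complex {1..m} K" "I \<subseteq> {1..m}"
    "\<delta> \<in> K" "\<tau> \<in> K" "\<delta> \<subseteq> \<tau>" "w \<in> topspace (wpp_simplex {1..m} P c \<delta>)"
  shows "wpp_in I P c (full_subcomplex K I) (\<tau> \<inter> I)
      (wproj_simplex {1..m} I P c \<tau> (iota_simplex {1..m} P c \<delta> \<tau> w)) =
    wpp_in I P c (full_subcomplex K I) (\<delta> \<inter> I) (wproj_simplex {1..m} I P c \<delta> w)"
proof -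
  have sub: "\<tau> \<subseteq> {1..m}" "\<delta> \<subseteq> {1..m}" "\<delta> \<inter> I \<subseteq> \<tau> \<inter> I"
    using assms by (auto simp: abs_simplicial_complex_def)
  moreover have "wproj_simplex {1..m} I P c \<delta> w \<in> topspace (wpp_simplex I P c (\<delta> \<inter> I))"
    using continuous_map_image_subset_topspace[OF continuous_map_wproj_simplex[of "{1..m}" I \<delta>]]
      sub assms by blast
  ultimately show ?thesis
    using assms
    by (simp add: wproj_simplex_iota_simplex wpp_in_iota_simplex inter_in_full_subcomplex)
qed

lemma wproj_wpp_in:
  assumes "abs_simplicial_complex {1..m} K" "I \<subseteq> {1..m}"
    "\<tau> \<in> K" "w \<in> topspace (wpp_simplex {1..m} P c \<tau>)"
  shows "wproj {1..m} I P c K (wpp_in {1..m} P c K \<tau> w) =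
    wpp_in I P c (full_subcomplex K I) (\<tau> \<inter> I) (wproj_simplex {1..m} I P c \<tau> w)"
  unfolding wproj_def wpp_in_def[of "{1..m}" P c K]
  by (rule colim_desc_in; (rule wproj_compatible[OF assms(1,2)])?; (rule assms(3,4))?)

lemma continuous_map_wproj:
  assumes "abs_simplicial_complex {1..m} K" "I \<subseteq> {1..m}"
  shows "continuous_map (wpp {1..m} P c K) (wpp I P c (full_subcomplex K I)) (wproj {1..m} I P c K)"
  unfolding wproj_def wpp_def[of "{1..m}" P c K]
proof (rule continuous_map_colim_desc)
  fix \<tau> assume "\<tau> \<in> K"
  then have "\<tau> \<subseteq> {1..m}"
    using assms by (auto simp: abs_simplicial_complex_def)
  then show "continuous_map (wpp_simplex {1..m} P c \<tau>) (wpp I P c (full_subcomplex K I))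
      (\<lambda>w. wpp_in I P c (full_subcomplex K I) (\<tau> \<inter> I) (wproj_simplex {1..m} I P c \<tau> w))"
    using continuous_map_compose[OF continuous_map_wproj_simplex continuous_map_wpp_in]
      inter_in_full_subcomplex[OF assms(1) \<open>\<tau> \<in> K\<close>] assms by (auto simp: o_def)
qed (rule wproj_compatible[OF assms])

text \<open>At the empty simplex the projection restricts the cell and raises it to exponents \<open>1\<close>.\<close>

lemma wproj_wpp_basept:
  assumes "abs_simplicial_complex {1..m} K" "I \<subseteq> {1..m}"
  shows "wproj {1..m} I P c K (wpp_basept {1..m} P c K) = wpp_basept I P c (full_subcomplex K I)"
proof -
  let ?b = "\<lambda>V. \<lambda>i\<in>V. basept (P i)"
  have b: "?b V \<in> pp_simplex V P {}" if "V \<subseteq> {1..m}" for V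
    using power_couple that by (blast intro: basept_in_pp_simplex)
  have "restrict (?b {1..m}) I = ?b I"
    using assms by (auto simp: fun_eq_iff)
  moreover have "{} \<in> K"
    using assms by (simp add: abs_simplicial_complex_def)
  ultimately show ?thesis
    using b[OF subset_refl] b[OF assms(2)] assms
    by (simp add: wpp_basept_def wproj_wpp_in eta_in_topspace wproj_simplex_eta power_map_self
        del: One_nat_def restrict_restrict)
qed

end

section \<open>Naturality of the projections\<close>

theorem proposition5p5:
  fixes P :: "nat \<Rightarrow> 'a couple" and m :: nat and c :: "nat set \<Rightarrow> nat \<Rightarrow> nat"
    and I :: "nat set" and K L :: "nat set set"
  assumes "\<forall>i\<in>{1..m}. power_couple (P i)"
    and "power_sequence m c"
    and "I \<subseteq> {1..m}"
    and "abs_simplicial_complex {1..m} K"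
    and "abs_simplicial_complex {1..m} L"
    and "L \<subseteq> K"
  shows "equal_pointed_maps
           (wpp {1..m} P c L) (wpp_basept {1..m} P c L)
           (wpp I P c (full_subcomplex K I)) (wpp_basept I P c (full_subcomplex K I))
           (iota I P c (full_subcomplex L I) (full_subcomplex K I) \<circ> wproj {1..m} I P c L)
           (wproj {1..m} I P c K \<circ> iota {1..m} P c L K)"
proof -
  interpret power_couple_sequence P m c
    using assms by unfold_locales auto
  have sub: "full_subcomplex L I \<subseteq> full_subcomplex K I"
    using assms by (auto simp: full_subcomplex_def)
  have empty: "{} \<in> L" "{} \<in> full_subcomplex L I"
    using assms by (auto simp: abs_simplicial_complex_def full_subcomplex_def)
  have pc: "power_couple (P i)" if "i \<in> I" for i
    using that assms by blast
  let ?f = "iota I P c (full_subcomplex L I) (full_subcomplex K I) \<circ> wproj {1..m} I P c L"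
  let ?g = "wproj {1..m} I P c K \<circ> iota {1..m} P c L K"
  have "?f y = ?g y" if y: "y \<in> topspace (wpp {1..m} P c L)" for y
  proof -
    from y obtain \<tau> w where \<tau>: "\<tau> \<in> L" and w: "w \<in> topspace (wpp_simplex {1..m} P c \<tau>)"
      and y_eq: "y = wpp_in {1..m} P c L \<tau> w"
      by (auto simp: topspace_wpp)
    have "\<tau> \<subseteq> {1..m}"
      using \<tau> assms by (auto simp: abs_simplicial_complex_def)
    then have "wproj_simplex {1..m} I P c \<tau> w \<in> topspace (wpp_simplex I P c (\<tau> \<inter> I))"
      using continuous_map_image_subset_topspace[OF continuous_map_wproj_simplex[of "{1..m}" I \<tau>]]
        assms w by blast
    moreover have "\<tau> \<in> K"
      using \<tau> assms by blast
    ultimately show ?thesis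
      using assms \<tau> w sub inter_in_full_subcomplex[OF assms(5) \<tau>]
      by (simp add: y_eq wproj_wpp_in iota_wpp_in del: One_nat_def)
  qed
  moreover have "continuous_map (wpp {1..m} P c L) (wpp I P c (full_subcomplex K I)) ?f"
    "continuous_map (wpp {1..m} P c L) (wpp I P c (full_subcomplex K I)) ?g"
    by (rule continuous_map_compose[OF continuous_map_wproj[OF assms(5,3)] continuous_map_iota[OF sub]],
        rule continuous_map_compose[OF continuous_map_iota[OF assms(6)] continuous_map_wproj[OF assms(4,3)]])
  moreover have "?f (wpp_basept {1..m} P c L) = wpp_basept I P c (full_subcomplex K I)"
    "?g (wpp_basept {1..m} P c L) = wpp_basept I P c (full_subcomplex K I)"
    by (simp_all only: o_apply wproj_wpp_basept[OF assms(5,3)] wproj_wpp_basept[OF assms(4,3)]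
        iota_wpp_basept[OF sub empty(2) pc] iota_wpp_basept[OF assms(6) empty(1) power_couple])
  ultimately show ?thesis
    unfolding equal_pointed_maps_def pointed_map_def by blast
qed

end
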